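(* Let $\mathcal{X}=[0,1]$, let $\mathcal{B}\subseteq\mathbb{R}$ be convex, and let $J:[0,1]\times\mathcal{B}\to\mathbb{R}$ be continuous, concave in $b$ on $\mathcal{B}$ for every $x\in[0,1]$, and concave in $x$ on $[0,1]$ for every $b\in\mathcal{B}$. Let $0=x_0<x_1<\dots<x_m=1$, and let $I_i=[x_{i-1},x_i)$ for $i=1,\dots,m-1$ and $I_m=[x_{m-1},x_m]$. Let $\underline{\delta}_i,\overline{\delta}_i\in\mathbb{R}$ for $i=1,\dots,m$, and assume there is a probability distribution $F$ on $[0,1]$ with $\underline{\delta}_i<F(I_i)<\overline{\delta}_i$ for all $i=1,\dots,m$. Let $\mathcal{F}$ be the set of all probability distributions $F$ on $[0,1]$ such that $\underline{\delta}_i\le F(I_i)\le\overline{\delta}_i$ for all $i=1,\dots,m$. Then the robust planning problem $$\sup_{b\in\mathcal{B}}\ \inf_{F\in\mathcal{F}}\ \mathbb{E}_{x\sim F}\,J(x,b)$$ is equivalent to the following convex optimization problem with finitely many variables and constraints: $$\begin{aligned}\underset{b,\bar\lambda,\underline\lambda,\eta}{\text{maximize}}\quad & \sum_{i=1}^m\left(\underline{\lambda}_i\,\underline{\delta}_i-\bar{\lambda}_i\,\overline{\delta}_i\right)-\eta\\ \text{subject to}\quad & J(x_{i-1},b)+\bar{\lambda}_i-\underline{\lambda}_i+\eta\ge 0,\quad i=1,\dots,m,\\ & J(x_i,b)+\bar{\lambda}_i-\underline{\lambda}_i+\eta\ge 0,\quad i=1,\dots,m,\\ & b\in\mathcal{B},\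 \bar\lambda\in\mathbb{R}^m_+,\ \underline\lambda\in\mathbb{R}^m_+,\ \eta\in\mathbb{R}.\end{aligned}$$ That is, the two problems have the same optimal value, and a decision $b\in\mathcal{B}$ is optimal for the robust planning problem if and only if it is the $b$-component of an optimal solution of the second problem.
   Context: $\mathbb{R}^m_+$ is the set of vectors with nonnegative entries. A probability distribution on $[0,1]$ is a Borel probability measure, and $\mathbb{E}_{x\sim F}\,h(x)=\int_{[0,1]}h\,dF$. Optimal values are suprema/infima in $[-\infty,+\infty]$. A decision $b\in\mathcal{B}$ is optimal for the robust planning problem if $\inf_{F\in\mathcal{F}}\mathbb{E}_{x\sim F}\,J(x,b)$ equals the (finite) optimal value; an optimal solution of the second problem is a feasible point attaining its (finite) optimal value. A convex optimization problem here means maximizing a concave (here linear) objective over a convex feasible set. *)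

theory Defs
  imports "HOL-Probability.Probability" "HOL-Library.Function_Algebras"
begin

text \<open>The pointwise vector space structure on functions, so that \<^const>\<open>convex\<close>, \<^const>\<open>concave_on\<close>
  and \<^const>\<open>linear\<close> apply to decision variables containing vectors indexed by natural numbers.\<close>

instantiation "fun" :: (type, real_vector) real_vector
begin

definition scaleR_fun_def: "c *\<^sub>R f = (\<lambda>i. c *\<^sub>R f i)"

instance
  by standard (simp_all add: scaleR_fun_def plus_fun_def algebra_simps)

end

text \<open>\<open>\<real>\<^sup>m\<^sub>+\<close>, with coordinates \<open>1, \<dots>, m\<close>; the coordinates outside this range are fixed to \<open>0\<close>.\<close>

definition nonneg_vectors :: "nat \<Rightarrow> (nat \<Rightarrow> real) set" where
  "nonneg_vectors m = {v. (\<forall>i\<in>{1..m}. 0 \<le> v i) \<and> (\<forall>i. i \<notin> {1..m} \<longrightarrow> v i = 0)}"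

definition distributions :: "real measure set" where
  "distributions = {F. prob_space F \<and> sets F = sets (restrict_space borel {0..1})}"

definition cell :: "nat \<Rightarrow> (nat \<Rightarrow> real) \<Rightarrow> nat \<Rightarrow> real set" where
  "cell m x i = (if i = m then {x (i - 1)..x i} else {x (i - 1)..<x i})"

definition ambiguity_set ::
  "nat \<Rightarrow> (nat \<Rightarrow> real) \<Rightarrow> (nat \<Rightarrow> real) \<Rightarrow> (nat \<Rightarrow> real) \<Rightarrow> real measure set" where
  "ambiguity_set m x \<delta>lo \<delta>up =
    {F \<in> distributions. \<forall>i\<in>{1..m}. \<delta>lo i \<le> measure F (cell m x i) \<and> measure F (cell m x i) \<le> \<delta>up i}"

definition worst_case :: "real measure set \<Rightarrow> (real \<Rightarrow> real \<Rightarrow> real) \<Rightarrow> real \<Rightarrow> ereal" where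
  "worst_case \<F> J b = (INF F\<in>\<F>. ereal (\<integral>x. J x b \<partial>F))"

definition optimal_value :: "'a set \<Rightarrow> ('a \<Rightarrow> ereal) \<Rightarrow> ereal" where
  "optimal_value S f = (SUP p\<in>S. f p)"

definition is_optimal :: "'a set \<Rightarrow> ('a \<Rightarrow> ereal) \<Rightarrow> 'a \<Rightarrow> bool" where
  "is_optimal S f p \<longleftrightarrow> p \<in> S \<and> \<bar>optimal_value S f\<bar> \<noteq> \<infinity> \<and> f p = optimal_value S f"

definition convex_maximization_problem :: "'a::real_vector set \<Rightarrow> ('a \<Rightarrow> real) \<Rightarrow> bool" where
  "convex_maximization_problem S f \<longleftrightarrow> convex S \<and> concave_on S f"

text \<open>The decision variables are ordered as \<open>(b, \<mu>up, \<mu>lo, \<eta>)\<close>: \<open>\<mu>up\<close> multiplies the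
  upper bounds \<open>\<delta>up\<close> and \<open>\<mu>lo\<close> the lower bounds \<open>\<delta>lo\<close>.\<close>

type_synonym dual_vars = "real \<times> (nat \<Rightarrow> real) \<times> (nat \<Rightarrow> real) \<times> real"

definition dual_feasible ::
  "nat \<Rightarrow> (nat \<Rightarrow> real) \<Rightarrow> real set \<Rightarrow> (real \<Rightarrow> real \<Rightarrow> real) \<Rightarrow> dual_vars set" where
  "dual_feasible m x B J =
    {(b, \<mu>up, \<mu>lo, \<eta>).
      (\<forall>i\<in>{1..m}. J (x (i - 1)) b + \<mu>up i - \<mu>lo i + \<eta> \<ge> 0) \<and>
      (\<forall>i\<in>{1..m}. J (x i) b + \<mu>up i - \<mu>lo i + \<eta> \<ge> 0) \<and>
      b \<in> B \<and> \<mu>up \<in> nonneg_vectors m \<and> \<mu>lo \<in> nonneg_vectors m}"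

definition dual_objective ::
  "nat \<Rightarrow> (nat \<Rightarrow> real) \<Rightarrow> (nat \<Rightarrow> real) \<Rightarrow> dual_vars \<Rightarrow> real" where
  "dual_objective m \<delta>lo \<delta>up =
    (\<lambda>(b, \<mu>up, \<mu>lo, \<eta>). (\<Sum>i=1..m. \<mu>lo i * \<delta>lo i - \<mu>up i * \<delta>up i) - \<eta>)"

end

(* For fixed b the worst case is a knapsack problem. By concavity the infimum of J(.,b) over a
   cell is the smaller of its two endpoint values c_i (approached, when the right endpoint is
   missing from the cell, by points close to it), so nature chooses cell masses p_i in
   [max 0 lo_i, up_i] with total mass 1 that minimise the sum of the c_i p_i. A greedy solution
   fills the cells up to a threshold \<tau>: p_i is maximal where c_i < \<tau> and minimal where
   c_i > \<tau>. Then \<eta> = -\<tau>, together with the positive and negative parts of \<tau> - c_i as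
   multipliers, is a dual solution with the same value, so the dual optimum is attained for
   every b. *)

theory Submission
  imports Defs
begin

section \<open>Greedy solution of the knapsack problem\<close>

text \<open>The threshold is the smallest cost \<open>c k\<close> at which filling all items of at
  most that cost reaches mass 1. Items tied with it absorb the remaining freedom, which is why
  \<open>p\<close> is left between its bounds there.\<close>

lemma knapsack_threshold:
  fixes c l u :: "'a \<Rightarrow> real"
  assumes fin: "finite A" and lu: "\<And>i. i \<in> A \<Longrightarrow> l i \<le> u i"
    and l1: "sum l A \<le> 1" and u1: "1 \<le> sum u A"
  obtains p \<tau> where "\<And>i. i \<in> A \<Longrightarrow> l i \<le> p i" "\<And>i. i \<in> A \<Longrightarrow> p i \<le> u i" "sum p A = 1"
    "\<And>i. i \<in> A \<Longrightarrow> c i < \<tau> \<Longrightarrow> p i = u i" "\<And>i. i \<in> A \<Longrightarrow> \<tau> < c i \<Longrightarrow> p i = l i"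
proof -
  \<comment> \<open>The two extreme fillings at threshold \<open>\<tau>\<close> differ only on items
    of cost exactly \<open>\<tau>\<close>: \<open>R\<close> fills them, \<open>L\<close> keeps them
    at the lower bound.\<close>
  define R where "R \<tau> = (\<Sum>i\<in>A. if c i \<le> \<tau> then u i else l i)" for \<tau>
  define L where "L \<tau> = (\<Sum>i\<in>A. if c i < \<tau> then u i else l i)" for \<tau>
  define T where "T = {j\<in>A. 1 \<le> R (c j)}"
  have ne: "A \<noteq> {}"
    using u1 by auto
  have "Max (c ` A) \<in> c ` A"
    using fin ne by simp
  then obtain j where j: "j \<in> A" "c j = Max (c ` A)"
    by auto
  have "R (c j) = sum u A"
    unfolding R_def using j fin by (intro sum.cong) auto
  with j u1 have "T \<noteq> {}"
    by (auto simp: T_def)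
  moreover have finT: "finite T"
    using fin by (simp add: T_def)
  ultimately have "Min (c ` T) \<in> c ` T"
    by simp
  then obtain k where k: "k \<in> T" "c k = Min (c ` T)"
    by auto
  have R1: "1 \<le> R (c k)"
    using k by (simp add: T_def)
  \<comment> \<open>By minimality of \<open>c k\<close>: \<open>L (c k)\<close> equals
    \<open>R\<close> at the next smaller cost \<open>c h\<close>, so a value above 1 would put
    \<open>h\<close> into \<open>T\<close>. If no smaller cost exists, it equals
    \<open>sum l A\<close>.\<close>
  have L1: "L (c k) \<le> 1"
  proof (rule ccontr)
    assume gt: "\<not> L (c k) \<le> 1"
    define S where "S = {i\<in>A. c i < c k}"
    have finS: "finite S"
      using fin by (simp add: S_def)
    show False
    proof (cases "S = {}")
      case True
      then have "L (c k) = sum l A"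
        unfolding L_def S_def by (intro sum.cong) auto
      with gt l1 show False by simp
    next
      case False
      with finS have "Max (c ` S) \<in> c ` S"
        by simp
      then obtain h where h: "h \<in> S" "c h = Max (c ` S)"
        by auto
      have "c i \<le> c h" if "i \<in> A" "c i < c k" for i
        using that h finS by (auto simp: S_def)
      then have "L (c k) = R (c h)"
        unfolding L_def R_def using h by (intro sum.cong) (force simp: S_def)+
      with gt h have "h \<in> T"
        by (auto simp: T_def S_def)
      with finT k have "c k \<le> c h"
        by simp
      with h show False by (simp add: S_def)
    qed
  qed
  \<comment> \<open>Since 1 lies between \<open>L (c k)\<close> and \<open>R (c k)\<close>, some
    mixture of the two fillings has mass exactly 1. If the two masses coincide, both are 1.\<close>
  obtain t where t: "0 \<le> t" "t \<le> 1" "(1 - t) * L (c k) + t * R (c k) = 1"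
  proof (cases "R (c k) = L (c k)")
    case True
    with L1 R1 show thesis by (intro that[of 0]) auto
  next
    case False
    define t where "t = (1 - L (c k)) / (R (c k) - L (c k))"
    have "t * (R (c k) - L (c k)) = 1 - L (c k)"
      using False by (simp add: t_def)
    moreover have "0 \<le> t" "t \<le> 1"
      using L1 R1 False by (simp_all add: t_def)
    ultimately show thesis
      by (intro that[of t]) (simp_all add: algebra_simps)
  qed
  \<comment> \<open>Away from the ties the two fillings agree, so mixing them keeps \<open>p\<close>
    at its bound there.\<close>
  define p where "p i = (1 - t) * (if c i < c k then u i else l i) + t * (if c i \<le> c k then u i else l i)" for i
  show thesis
  proof
    show "sum p A = 1"
      using t(3) by (simp add: p_def L_def R_def sum.distrib sum_distrib_left)
    fix i assume i: "i \<in> A"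
    have conv: "l i \<le> (1 - t) * l i + t * u i" "(1 - t) * l i + t * u i \<le> u i"
      using mult_left_mono[OF lu[OF i] t(1)] mult_left_mono[OF lu[OF i], of "1 - t"] t
      by (simp_all add: algebra_simps)
    have eq: "(1 - t) * y + t * y = y" for y
      by (simp add: algebra_simps)
    show "l i \<le> p i" "p i \<le> u i"
      using conv lu[OF i] by (auto simp: p_def eq)
    show "p i = u i" if "c i < c k"
      using that by (simp add: p_def eq)
    show "p i = l i" if "c k < c i"
      using that by (simp add: p_def eq)
  qed
qed

text \<open>Complementary slackness: each multiplier is nonzero only where its bound is tight for
  the threshold solution, so the two values agree. The lower bound \<open>max 0 (lo i)\<close>
  builds in nonnegativity of the masses, as \<open>lo i\<close> may be negative.\<close>

lemma knapsack_duality: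
  fixes c lo up :: "'a \<Rightarrow> real"
  assumes "finite A" "\<And>i. i \<in> A \<Longrightarrow> lo i \<le> up i" "\<And>i. i \<in> A \<Longrightarrow> 0 \<le> up i"
    "(\<Sum>i\<in>A. max 0 (lo i)) \<le> 1" "1 \<le> sum up A"
  obtains p \<mu> \<nu> \<eta> where "\<And>i. i \<in> A \<Longrightarrow> 0 \<le> p i" "\<And>i. i \<in> A \<Longrightarrow> lo i \<le> p i"
    "\<And>i. i \<in> A \<Longrightarrow> p i \<le> up i" "sum p A = 1"
    "\<And>i. 0 \<le> \<mu> i" "\<And>i. 0 \<le> \<nu> i" "\<And>i. i \<in> A \<Longrightarrow> c i + \<mu> i - \<nu> i + \<eta> \<ge> 0"
    "(\<Sum>i\<in>A. \<nu> i * lo i - \<mu> i * up i) - \<eta> = (\<Sum>i\<in>A. p i * c i)"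
proof -
  obtain p \<tau> where p: "\<And>i. i \<in> A \<Longrightarrow> max 0 (lo i) \<le> p i" "\<And>i. i \<in> A \<Longrightarrow> p i \<le> up i" "sum p A = 1"
    "\<And>i. i \<in> A \<Longrightarrow> c i < \<tau> \<Longrightarrow> p i = up i" "\<And>i. i \<in> A \<Longrightarrow> \<tau> < c i \<Longrightarrow> p i = max 0 (lo i)"
    using knapsack_threshold[of A "\<lambda>i. max 0 (lo i)" up c] assms by auto
  define \<mu> where "\<mu> i = max 0 (\<tau> - c i)" for i
  \<comment> \<open>If \<open>lo i < 0\<close> and \<open>\<tau> < c i\<close>, the tight bound is
    \<open>p i = 0\<close> and not \<open>lo i\<close>; a positive multiplier on \<open>lo i\<close>
    would then lower the dual value.\<close>
  define \<nu> where "\<nu> i = (if 0 \<le> lo i then max 0 (c i - \<tau>) else 0)" for i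
  show thesis
  proof (rule that[of p \<mu> \<nu> "-\<tau>"])
    have slack: "\<nu> i * lo i - \<mu> i * up i = p i * (c i - \<tau>)" if "i \<in> A" for i
      using p(4,5)[OF that] by (cases "c i" \<tau> rule: linorder_cases) (auto simp: \<mu>_def \<nu>_def algebra_simps)
    have "(\<Sum>i\<in>A. p i * \<tau>) = \<tau>"
      using p(3) by (simp flip: sum_distrib_right)
    then show "(\<Sum>i\<in>A. \<nu> i * lo i - \<mu> i * up i) - - \<tau> = (\<Sum>i\<in>A. p i * c i)"
      by (simp add: slack right_diff_distrib sum_subtractf)
  qed (use p in \<open>force simp: \<mu>_def \<nu>_def\<close>)+
qed

section \<open>Partitions of the unit interval\<close>

locale partition =
  fixes m :: nat and x :: "nat \<Rightarrow> real"
  assumes x_0: "x 0 = 0" and x_m: "x m = 1" and x_step: "\<And>i. i \<in> {1..m} \<Longrightarrow> x (i - 1) < x i"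
begin

lemma x_mono: "i \<le> j \<Longrightarrow> j \<le> m \<Longrightarrow> x i \<le> x j"
proof (induction rule: dec_induct)
  case (step n)
  with x_step[of "Suc n"] show ?case by simp
qed simp

lemma x_in_unit: "i \<le> m \<Longrightarrow> x i \<in> {0..1}"
  using x_mono[of 0 i] x_mono[of i m] x_0 x_m by simp

lemma cell_subset:
  assumes "i \<in> {1..m}"
  shows "cell m x i \<subseteq> {x (i - 1)..x i}" "cell m x i \<subseteq> {0..1}"
proof -
  show "cell m x i \<subseteq> {x (i - 1)..x i}"
    by (auto simp: cell_def)
  moreover have "{x (i - 1)..x i} \<subseteq> {0..1}"
    using x_in_unit[of i] x_in_unit[of "i - 1"] assms by auto
  ultimately show "cell m x i \<subseteq> {0..1}"
    by blast
qed

text \<open>For \<open>y < 1\<close> the cell ends at the first grid point strictly beyond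
  \<open>y\<close>. No grid point lies beyond 1, which belongs to the last cell, closed on the
  right.\<close>

lemma cell_exists:
  assumes "y \<in> {0..1}"
  shows "\<exists>i\<in>{1..m}. y \<in> cell m x i"
proof (cases "y = 1")
  case True
  have "m \<noteq> 0"
    using x_0 x_m by (intro notI) simp
  with True x_step[of m] x_m show ?thesis
    by (intro bexI[of _ m]) (auto simp: cell_def)
next
  case False
  define i where "i = (LEAST i. y < x i)"
  have ym: "y < x m"
    using assms False x_m by simp
  then have yi: "y < x i" and im: "i \<le> m"
    unfolding i_def by (auto intro: LeastI Least_le)
  have i0: "i \<noteq> 0"
    using yi x_0 assms by (intro notI) simp
  then have "x (i - 1) \<le> y"
    using not_less_Least[of "i - 1" "\<lambda>i. y < x i"] by (simp add: i_def not_less)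
  with yi i0 im show ?thesis
    by (intro bexI[of _ i]) (auto simp: cell_def)
qed

lemma cell_disjoint:
  assumes "i \<in> {1..m}" "j \<in> {1..m}" "i < j"
  shows "cell m x i \<inter> cell m x j = {}"
proof -
  have "x i \<le> x (j - 1)"
    using assms by (intro x_mono) auto
  \<comment> \<open>Hence cell \<open>i\<close> is half-open and omits \<open>x i\<close>, the only
    point it could share with cell \<open>j\<close>.\<close>
  moreover have "i \<noteq> m"
    using assms by auto
  ultimately show ?thesis
    by (auto simp: cell_def)
qed

lemma cell_unique:
  assumes "i \<in> {1..m}" "j \<in> {1..m}" "y \<in> cell m x i" "y \<in> cell m x j"
  shows "i = j"
  using cell_disjoint[OF assms(1,2)] cell_disjoint[OF assms(2,1)] assms(3,4)
  by (meson disjoint_iff linorder_neqE_nat)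

lemma sum_indicator_cell:
  assumes "i \<in> {1..m}" "y \<in> cell m x i"
  shows "(\<Sum>j=1..m. a j * indicator (cell m x j) y) = (a i :: real)"
proof -
  have "a j * indicator (cell m x j) y = (if j = i then a i else 0)" if "j \<in> {1..m}" for j
    using assms(2) cell_unique[OF assms(1) that assms(2)] by (cases "j = i") (auto simp: indicator_def)
  then have "(\<Sum>j=1..m. a j * indicator (cell m x j) y) = (\<Sum>j=1..m. if j = i then a i else 0)"
    by (rule sum.cong[OF refl])
  then show ?thesis
    using assms by simp
qed

lemma sets_cell:
  assumes "i \<in> {1..m}" "F \<in> distributions"
  shows "cell m x i \<in> sets F"
proof -
  have "cell m x i \<in> sets borel"
    by (simp add: cell_def)
  with cell_subset(2)[OF assms(1)] assms(2) show ?thesis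
    by (auto simp: distributions_def sets_restrict_space_iff)
qed

end

section \<open>Integrability of continuous functions on the unit interval\<close>

lemma space_distribution: "F \<in> distributions \<Longrightarrow> space F = {0..1}"
  using sets_eq_imp_space_eq[of F "restrict_space borel {0..1}"]
  by (simp add: distributions_def)

lemma borel_measurable_distribution:
  fixes g :: "real \<Rightarrow> real"
  assumes "F \<in> distributions" "continuous_on {0..1} g"
  shows "g \<in> borel_measurable F"
proof -
  have "sets F = sets (restrict_space borel {0..1})"
    using assms(1) by (simp add: distributions_def)
  then have "(borel_measurable F :: (real \<Rightarrow> real) set) = borel_measurable (restrict_space borel {0..1})"
    by (intro measurable_cong_sets) auto
  with borel_measurable_continuous_on_restrict[OF assms(2)] show ?thesis
    by simp
qed

lemma integrable_distribution:
  fixes g :: "real \<Rightarrow> real"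
  assumes F: "F \<in> distributions" and g: "continuous_on {0..1} g"
  shows "integrable F g"
proof -
  interpret prob_space F
    using F by (simp add: distributions_def)
  have "bounded (g ` {0..1})"
    using g by (intro compact_imp_bounded compact_continuous_image) auto
  then obtain K where "\<And>y. y \<in> {0..1} \<Longrightarrow> norm (g y) \<le> K"
    unfolding bounded_iff by blast
  then show ?thesis
    using borel_measurable_distribution[OF F g] space_distribution[OF F]
    by (intro integrable_const_bound[of _ K]) auto
qed

section \<open>Integrals, cell masses and discrete distributions\<close>

context partition
begin

lemma integral_step_function:
  assumes F: "F \<in> distributions"
  shows "integrable F (\<lambda>y. \<Sum>j=1..m. a j * indicator (cell m x j) y :: real)"
    "(\<integral>y. (\<Sum>j=1..m. a j * indicator (cell m x j) y) \<partial>F) = (\<Sum>j=1..m. a j * measure F (cell m x j))"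
proof -
  interpret prob_space F
    using F by (simp add: distributions_def)
  have ind: "integrable F (\<lambda>y. indicator (cell m x j) y :: real)" if "j \<in> {1..m}" for j
    using sets_cell[OF that F] by (simp add: integrable_indicator_iff emeasure_eq_measure)
  then show "integrable F (\<lambda>y. \<Sum>j=1..m. a j * indicator (cell m x j) y :: real)"
    by (intro Bochner_Integration.integrable_sum integrable_mult_right) auto
  have "(\<integral>y. (\<Sum>j=1..m. a j * indicator (cell m x j) y) \<partial>F)
      = (\<Sum>j=1..m. \<integral>y. a j * indicator (cell m x j) y \<partial>F)"
    using ind by (intro Bochner_Integration.integral_sum integrable_mult_right) auto
  also have "\<dots> = (\<Sum>j=1..m. a j * measure F (cell m x j))"
    using sets_cell[OF _ F] sets.sets_into_space[OF sets_cell[OF _ F]]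
    by (intro sum.cong) (auto simp: Int_absorb1)
  finally show "(\<integral>y. (\<Sum>j=1..m. a j * indicator (cell m x j) y) \<partial>F)
      = (\<Sum>j=1..m. a j * measure F (cell m x j))" .
qed

text \<open>On the unit interval the constant 1 is the step function with all coefficients 1,
  because the cells partition the interval.\<close>

lemma sum_measure_cell:
  assumes F: "F \<in> distributions"
  shows "(\<Sum>i=1..m. measure F (cell m x i)) = 1"
proof -
  interpret prob_space F
    using F by (simp add: distributions_def)
  have "(\<Sum>i=1..m. measure F (cell m x i)) = (\<integral>y. (\<Sum>j=1..m. 1 * indicator (cell m x j) y) \<partial>F)"
    using integral_step_function(2)[OF F, of "\<lambda>_. 1"] by simp
  also have "\<dots> = (\<integral>y. 1 \<partial>F)"
  proof (rule Bochner_Integration.integral_cong)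
    fix y assume "y \<in> space F"
    then obtain i where "i \<in> {1..m}" "y \<in> cell m x i"
      using cell_exists[of y] space_distribution[OF F] by blast
    then show "(\<Sum>j=1..m. 1 * indicator (cell m x j) y) = (1::real)"
      by (rule sum_indicator_cell)
  qed simp
  finally show ?thesis
    by (simp add: prob_space)
qed

text \<open>A concave function on an interval is bounded below by its smaller endpoint value, so
  \<open>g\<close> dominates the step function of these values.\<close>

lemma integral_ge_cell_minima:
  assumes F: "F \<in> distributions" and cont: "continuous_on {0..1} g" and conc: "concave_on {0..1} g"
  shows "(\<Sum>i=1..m. min (g (x (i - 1))) (g (x i)) * measure F (cell m x i)) \<le> (\<integral>y. g y \<partial>F)"
proof -
  let ?c = "\<lambda>i. min (g (x (i - 1))) (g (x i))"
  have "?c i \<le> g y" if i: "i \<in> {1..m}" and y: "y \<in> cell m x i" for i y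
  proof -
    have "{x (i - 1)..x i} \<subseteq> {0..1}"
      using x_in_unit[of i] x_in_unit[of "i - 1"] i by auto
    then have "convex_on {x (i - 1)..x i} (\<lambda>y. - g y)"
      using conc convex_on_subset unfolding concave_on_def by fastforce
    from convex_on_le_max[OF this, of y] cell_subset(1)[OF i] y show ?thesis
      by (auto simp: min_def max_def split: if_splits)
  qed
  then have "(\<Sum>j=1..m. ?c j * indicator (cell m x j) y) \<le> g y" if "y \<in> {0..1}" for y
    using cell_exists[OF that] sum_indicator_cell[of _ y ?c] by fastforce
  then have "(\<integral>y. (\<Sum>j=1..m. ?c j * indicator (cell m x j) y) \<partial>F) \<le> (\<integral>y. g y \<partial>F)"
    using space_distribution[OF F]
    by (intro integral_mono integral_step_function(1) integrable_distribution F cont) auto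
  then show ?thesis
    unfolding integral_step_function(2)[OF F] .
qed

text \<open>The slack \<open>e\<close> is needed when the smaller value sits at a right endpoint
  that the cell omits; continuity supplies a nearby point inside.\<close>

lemma near_minimal_point_of_cell:
  assumes cont: "continuous_on {0..1} (g :: real \<Rightarrow> real)" and i: "i \<in> {1..m}" and e: "0 < e"
  shows "\<exists>y\<in>cell m x i. g y \<le> min (g (x (i - 1))) (g (x i)) + e"
proof (cases "g (x (i - 1)) \<le> g (x i)")
  case True
  with x_step[OF i] e show ?thesis
    by (intro bexI[of _ "x (i - 1)"]) (auto simp: cell_def)
next
  case False
  have xi: "x i \<in> {0..1}" "x (i - 1) \<in> {0..1}"
    using i x_in_unit[of i] x_in_unit[of "i - 1"] by auto
  then obtain d where d: "0 < d" "\<And>y. y \<in> {0..1} \<Longrightarrow> dist y (x i) < d \<Longrightarrow> dist (g y) (g (x i)) < e"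
    using cont e unfolding continuous_on_iff by metis
  \<comment> \<open>Half of \<open>d\<close> keeps \<open>y\<close> strictly within distance
    \<open>d\<close> of \<open>x i\<close>; the maximum keeps it from leaving the cell on the
    left.\<close>
  define y where "y = max (x (i - 1)) (x i - d / 2)"
  have y: "x (i - 1) \<le> y" "y < x i" "dist y (x i) < d"
    using x_step[OF i] d(1) by (auto simp: y_def dist_real_def)
  with xi have "dist (g y) (g (x i)) < e"
    by (intro d) auto
  with y False show ?thesis
    by (intro bexI[of _ y]) (auto simp: cell_def dist_real_def)
qed

text \<open>The witness is the image under \<open>y\<close> of the measure on the indices with
  weights \<open>p\<close>. Disjointness of the cells makes \<open>y i\<close> the only atom in cell
  \<open>i\<close>.\<close>

lemma discrete_distribution:
  assumes p: "\<And>i. i \<in> {1..m} \<Longrightarrow> 0 \<le> p i" "sum p {1..m} = 1"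
    and y: "\<And>i. i \<in> {1..m} \<Longrightarrow> y i \<in> cell m x i"
  shows "\<exists>F\<in>distributions. (\<forall>i\<in>{1..m}. measure F (cell m x i) = p i) \<and>
    (\<forall>g :: real \<Rightarrow> real. continuous_on {0..1} g \<longrightarrow> (\<integral>y. g y \<partial>F) = (\<Sum>i=1..m. p i * g (y i)))"
proof -
  define P where "P = point_measure {1..m} (\<lambda>i. ennreal (p i))"
  define F where "F = distr P (restrict_space borel {0..1}) y"
  have "emeasure P {1..m} = ennreal (sum p {1..m})"
    unfolding P_def using p(1) by (simp only: emeasure_point_measure_finite finite_atLeastAtMost order_refl sum_ennreal)
  then interpret P: prob_space P
    using p by (intro prob_spaceI) (simp add: P_def space_point_measure)
  have meas: "y \<in> measurable P (restrict_space borel {0..1})"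
    using y cell_subset(2) unfolding P_def by (fastforce simp: measurable_point_measure_eq1 space_restrict_space)
  have F: "F \<in> distributions"
    using P.prob_space_distr[OF meas] by (simp add: F_def distributions_def)
  \<comment> \<open>Stated for measurable \<open>g\<close>, so that it covers the indicators of
    cells as well as continuous functions.\<close>
  have int: "(\<integral>y. g y \<partial>F) = (\<Sum>i=1..m. p i * g (y i))" if "g \<in> borel_measurable F" for g :: "real \<Rightarrow> real"
  proof -
    have "(\<integral>y. g y \<partial>F) = (\<integral>i. g (y i) \<partial>P)"
      using that meas unfolding F_def by (intro integral_distr) simp_all
    also have "\<dots> = (\<Sum>i=1..m. p i *\<^sub>R g (y i))"
      unfolding P_def using p(1) by (intro lebesgue_integral_point_measure_finite) auto
    finally show ?thesis by simp
  qed
  have "measure F (cell m x i) = p i" if i: "i \<in> {1..m}" for i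
  proof -
    have "measure F (cell m x i) = (\<integral>z. indicator (cell m x i) z \<partial>F)"
      using sets.sets_into_space[OF sets_cell[OF i F]] by (simp add: Int_absorb2)
    also have "\<dots> = (\<Sum>j=1..m. p j * indicator (cell m x i) (y j))"
      using sets_cell[OF i F] by (intro int) auto
    also have "\<dots> = (\<Sum>j=1..m. if j = i then p i else 0)"
      using y i cell_unique[OF i] by (intro sum.cong) (auto simp: indicator_def)
    finally show ?thesis
      using i by simp
  qed
  with F int borel_measurable_distribution[OF F] show ?thesis
    by blast
qed

section \<open>Strong duality for a fixed decision\<close>

text \<open>The two constraints of a cell bound \<open>\<mu>lo i - \<mu>up i\<close> by the endpoint
  minimum plus \<open>\<eta>\<close>. Weighting by the cell masses and summing gives a lower bound
  for every admissible \<open>F\<close>.\<close>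

lemma weak_duality:
  assumes cont: "continuous_on {0..1} (\<lambda>y. J y b)" and conc: "concave_on {0..1} (\<lambda>y. J y b)"
    and feas: "(b, \<mu>up, \<mu>lo, \<eta>) \<in> dual_feasible m x B J"
  shows "ereal (dual_objective m \<delta>lo \<delta>up (b, \<mu>up, \<mu>lo, \<eta>)) \<le> worst_case (ambiguity_set m x \<delta>lo \<delta>up) J b"
  unfolding worst_case_def
proof (rule INF_greatest)
  fix F assume "F \<in> ambiguity_set m x \<delta>lo \<delta>up"
  then have F: "F \<in> distributions"
    and lo: "\<And>i. i \<in> {1..m} \<Longrightarrow> \<delta>lo i \<le> measure F (cell m x i)"
    and up: "\<And>i. i \<in> {1..m} \<Longrightarrow> measure F (cell m x i) \<le> \<delta>up i"
    by (auto simp: ambiguity_set_def)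
  let ?c = "\<lambda>i. min (J (x (i - 1)) b) (J (x i) b)"
  let ?q = "\<lambda>i. measure F (cell m x i)"
  have "(\<Sum>i=1..m. \<mu>lo i * \<delta>lo i - \<mu>up i * \<delta>up i) \<le> (\<Sum>i=1..m. ?c i * ?q i + \<eta> * ?q i)"
  proof (rule sum_mono)
    fix i assume i: "i \<in> {1..m}"
    have nn: "0 \<le> \<mu>lo i" "0 \<le> \<mu>up i"
      using feas i by (simp_all add: dual_feasible_def nonneg_vectors_def)
    have "J (x (i - 1)) b + \<mu>up i - \<mu>lo i + \<eta> \<ge> 0" "J (x i) b + \<mu>up i - \<mu>lo i + \<eta> \<ge> 0"
      using feas i by (simp_all add: dual_feasible_def)
    then have c: "\<mu>lo i - \<mu>up i \<le> ?c i + \<eta>"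
      by linarith
    have "\<mu>lo i * \<delta>lo i - \<mu>up i * \<delta>up i \<le> \<mu>lo i * ?q i - \<mu>up i * ?q i"
      using lo[OF i] up[OF i] nn by (intro diff_mono mult_left_mono)
    also have "\<dots> \<le> ?c i * ?q i + \<eta> * ?q i"
      using mult_right_mono[OF c, of "?q i"] by (simp add: algebra_simps)
    finally show "\<mu>lo i * \<delta>lo i - \<mu>up i * \<delta>up i \<le> ?c i * ?q i + \<eta> * ?q i" .
  qed
  \<comment> \<open>The masses sum to 1, so \<open>\<eta>\<close> is the multiplier of the
    normalisation constraint.\<close>
  also have "\<dots> = (\<Sum>i=1..m. ?c i * ?q i) + \<eta>"
    using sum_measure_cell[OF F] by (simp add: sum.distrib flip: sum_distrib_left)
  also have "\<dots> \<le> (\<integral>y. J y b \<partial>F) + \<eta>"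
    using integral_ge_cell_minima[OF F cont conc] by simp
  finally show "ereal (dual_objective m \<delta>lo \<delta>up (b, \<mu>up, \<mu>lo, \<eta>)) \<le> ereal (\<integral>y. J y b \<partial>F)"
    by (simp add: dual_objective_def)
qed

text \<open>The knapsack multipliers attain the dual optimum, while the knapsack masses are realised
  by discrete distributions whose expectation is within any \<open>e > 0\<close> of the same
  value.\<close>

lemma strong_duality:
  assumes cont: "continuous_on {0..1} (\<lambda>y. J y b)" and conc: "concave_on {0..1} (\<lambda>y. J y b)"
    and b: "b \<in> B" and nonempty: "F \<in> ambiguity_set m x \<delta>lo \<delta>up"
  obtains \<mu>up \<mu>lo \<eta> where "(b, \<mu>up, \<mu>lo, \<eta>) \<in> dual_feasible m x B J"
    "worst_case (ambiguity_set m x \<delta>lo \<delta>up) J b = ereal (dual_objective m \<delta>lo \<delta>up (b, \<mu>up, \<mu>lo, \<eta>))"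
proof -
  let ?c = "\<lambda>i. min (J (x (i - 1)) b) (J (x i) b)"
  have F: "F \<in> distributions"
    and lo: "\<And>i. i \<in> {1..m} \<Longrightarrow> \<delta>lo i \<le> measure F (cell m x i)"
    and up: "\<And>i. i \<in> {1..m} \<Longrightarrow> measure F (cell m x i) \<le> \<delta>up i"
    using nonempty by (auto simp: ambiguity_set_def)
  \<comment> \<open>The cell masses of \<open>F\<close> show that the knapsack problem is
    feasible.\<close>
  have "(\<Sum>i=1..m. max 0 (\<delta>lo i)) \<le> (\<Sum>i=1..m. measure F (cell m x i))"
    using lo by (intro sum_mono) auto
  moreover have "(\<Sum>i=1..m. measure F (cell m x i)) \<le> (\<Sum>i=1..m. \<delta>up i)"
    using up by (intro sum_mono) auto
  moreover have "\<delta>lo i \<le> \<delta>up i" "0 \<le> \<delta>up i" if "i \<in> {1..m}" for i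
    using lo[OF that] up[OF that] measure_nonneg[of F "cell m x i"] by linarith+
  ultimately obtain p \<mu> \<nu> \<eta> where p: "\<And>i. i \<in> {1..m} \<Longrightarrow> 0 \<le> p i" "\<And>i. i \<in> {1..m} \<Longrightarrow> \<delta>lo i \<le> p i"
      "\<And>i. i \<in> {1..m} \<Longrightarrow> p i \<le> \<delta>up i" "sum p {1..m} = 1"
    and dual: "\<And>i. 0 \<le> \<mu> i" "\<And>i. 0 \<le> \<nu> i" "\<And>i. i \<in> {1..m} \<Longrightarrow> ?c i + \<mu> i - \<nu> i + \<eta> \<ge> 0"
    and val: "(\<Sum>i=1..m. \<nu> i * \<delta>lo i - \<mu> i * \<delta>up i) - \<eta> = (\<Sum>i=1..m. p i * ?c i)"
    using sum_measure_cell[OF F] by (elim knapsack_duality[of "{1..m}" \<delta>lo \<delta>up ?c, rotated 5]) auto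
  \<comment> \<open>Cut off to 0 outside \<open>{1..m}\<close>, as membership in
    \<open>nonneg_vectors\<close> requires.\<close>
  define \<mu>up where "\<mu>up i = (if i \<in> {1..m} then \<mu> i else 0)" for i
  define \<mu>lo where "\<mu>lo i = (if i \<in> {1..m} then \<nu> i else 0)" for i
  have feas: "(b, \<mu>up, \<mu>lo, \<eta>) \<in> dual_feasible m x B J"
  proof -
    have "J (x (i - 1)) b + \<mu> i - \<nu> i + \<eta> \<ge> 0" "J (x i) b + \<mu> i - \<nu> i + \<eta> \<ge> 0" if "i \<in> {1..m}" for i
      using dual(3)[OF that] by linarith+
    with b dual(1,2) show ?thesis
      by (simp add: dual_feasible_def nonneg_vectors_def \<mu>up_def \<mu>lo_def)
  qed
  have obj: "dual_objective m \<delta>lo \<delta>up (b, \<mu>up, \<mu>lo, \<eta>) = (\<Sum>i=1..m. p i * ?c i)"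
    using val by (simp add: dual_objective_def \<mu>up_def \<mu>lo_def)
  have "worst_case (ambiguity_set m x \<delta>lo \<delta>up) J b \<le> ereal (\<Sum>i=1..m. p i * ?c i) + ereal e"
    if e: "0 < e" for e
  proof -
    have "\<forall>i\<in>{1..m}. \<exists>z. z \<in> cell m x i \<and> J z b \<le> ?c i + e"
      using near_minimal_point_of_cell[OF cont _ e] by blast
    from bchoice[OF this] obtain y where
      y: "\<And>i. i \<in> {1..m} \<Longrightarrow> y i \<in> cell m x i" "\<And>i. i \<in> {1..m} \<Longrightarrow> J (y i) b \<le> ?c i + e"
      by blast
    obtain G where G: "G \<in> distributions" "\<And>i. i \<in> {1..m} \<Longrightarrow> measure G (cell m x i) = p i"
      and "\<And>g :: real \<Rightarrow> real. continuous_on {0..1} g \<Longrightarrow> (\<integral>y. g y \<partial>G) = (\<Sum>i=1..m. p i * g (y i))"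
      using discrete_distribution[OF p(1,4) y(1)] by blast
    from this(3)[OF cont] have int: "(\<integral>y. J y b \<partial>G) = (\<Sum>i=1..m. p i * J (y i) b)" .
    have "G \<in> ambiguity_set m x \<delta>lo \<delta>up"
      using G p by (auto simp: ambiguity_set_def)
    then have "worst_case (ambiguity_set m x \<delta>lo \<delta>up) J b \<le> ereal (\<integral>y. J y b \<partial>G)"
      unfolding worst_case_def by (rule INF_lower)
    also have "(\<integral>y. J y b \<partial>G) \<le> (\<Sum>i=1..m. p i * (?c i + e))"
      unfolding int using p y by (intro sum_mono mult_left_mono)
    also have "\<dots> = (\<Sum>i=1..m. p i * ?c i) + e"
      using p(4) by (simp add: distrib_left sum.distrib flip: sum_distrib_right)
    finally show ?thesis by simp
  qed
  then have "worst_case (ambiguity_set m x \<delta>lo \<delta>up) J b \<le> ereal (\<Sum>i=1..m. p i * ?c i)"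
    by (rule ereal_le_epsilon2)
  with weak_duality[OF cont conc feas, of \<delta>lo \<delta>up] show thesis
    using feas obj by (intro that) auto
qed

end

section \<open>The reformulation\<close>

lemma linear_dual_objective: "linear (dual_objective m \<delta>lo \<delta>up)"
proof (rule linearI)
  show "dual_objective m \<delta>lo \<delta>up (p + q) = dual_objective m \<delta>lo \<delta>up p + dual_objective m \<delta>lo \<delta>up q" for p q
    by (cases p; cases q)
       (simp add: dual_objective_def plus_fun_def algebra_simps sum.distrib sum_subtractf)
  show "dual_objective m \<delta>lo \<delta>up (r *\<^sub>R p) = r *\<^sub>R dual_objective m \<delta>lo \<delta>up p" for r p
    by (cases p) (simp add: dual_objective_def scaleR_fun_def right_diff_distrib sum_distrib_left mult.assoc)
qed

lemma concave_on_linear: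
  assumes "convex S" "linear f"
  shows "concave_on S f"
  using assms by (simp add: concave_on_iff linear_add linear_scale)

lemma convex_nonneg_vectors: "convex (nonneg_vectors m)"
  by (rule convexI) (auto simp: nonneg_vectors_def scaleR_fun_def plus_fun_def)

text \<open>Each constraint function is \<open>J (x j)\<close>, concave in \<open>b\<close>, plus a
  linear function of the multipliers, so its superlevel sets are convex.\<close>

lemma convex_dual_feasible:
  assumes B: "convex B"
    and conc: "\<And>i. i \<le> m \<Longrightarrow> concave_on B (J (x i))"
  shows "convex (dual_feasible m x B J)"
proof (rule convexI)
  fix p q :: dual_vars and u v :: real
  assume p: "p \<in> dual_feasible m x B J" and q: "q \<in> dual_feasible m x B J"
    and uv: "0 \<le> u" "0 \<le> v" "u + v = 1"
  obtain b \<mu> \<nu> \<eta> where p_eq: "p = (b, \<mu>, \<nu>, \<eta>)"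
    by (cases p)
  obtain b' \<mu>' \<nu>' \<eta>' where q_eq: "q = (b', \<mu>', \<nu>', \<eta>')"
    by (cases q)
  have mem: "b \<in> B" "b' \<in> B" "\<mu> \<in> nonneg_vectors m" "\<nu> \<in> nonneg_vectors m"
      "\<mu>' \<in> nonneg_vectors m" "\<nu>' \<in> nonneg_vectors m"
    using p q by (auto simp: p_eq q_eq dual_feasible_def)
  \<comment> \<open>The grid index \<open>j\<close> is separate from \<open>i\<close>, so one
    statement serves both endpoints \<open>j = i - 1\<close> and \<open>j = i\<close>.\<close>
  have "J (x j) (u * b + v * b') + (u * \<mu> i + v * \<mu>' i) - (u * \<nu> i + v * \<nu>' i) + (u * \<eta> + v * \<eta>') \<ge> 0"
    if "j \<le> m" "J (x j) b + \<mu> i - \<nu> i + \<eta> \<ge> 0" "J (x j) b' + \<mu>' i - \<nu>' i + \<eta>' \<ge> 0" for i j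
  proof -
    have "u * J (x j) b + v * J (x j) b' \<le> J (x j) (u * b + v * b')"
      using conc[OF that(1)] mem uv by (auto simp: concave_on_iff)
    moreover have "0 \<le> u * (J (x j) b + \<mu> i - \<nu> i + \<eta>) + v * (J (x j) b' + \<mu>' i - \<nu>' i + \<eta>')"
      using that uv by simp
    ultimately show ?thesis
      by (simp add: algebra_simps)
  qed
  moreover have "u * b + v * b' \<in> B"
    using convexD[OF B mem(1,2) uv] by simp
  moreover have "u *\<^sub>R \<mu> + v *\<^sub>R \<mu>' \<in> nonneg_vectors m" "u *\<^sub>R \<nu> + v *\<^sub>R \<nu>' \<in> nonneg_vectors m"
    using convexD[OF convex_nonneg_vectors] mem uv by auto
  ultimately show "u *\<^sub>R p + v *\<^sub>R q \<in> dual_feasible m x B J"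
    using p q by (auto simp: p_eq q_eq dual_feasible_def scaleR_fun_def plus_fun_def)
qed

text \<open>Partial maximisation: \<open>f b\<close> is the attained maximum of
  \<open>h (b, d)\<close> over the feasible \<open>d\<close>, so maximising in one or two stages is
  the same.\<close>

lemma optimal_value_projection:
  fixes f :: "'a \<Rightarrow> ereal" and h :: "'a \<times> 'c \<Rightarrow> ereal"
  assumes le: "\<And>b d. (b, d) \<in> S \<Longrightarrow> b \<in> B \<and> h (b, d) \<le> f b"
    and att: "\<And>b. b \<in> B \<Longrightarrow> \<exists>d. (b, d) \<in> S \<and> h (b, d) = f b"
  shows "optimal_value B f = optimal_value S h"
    and "is_optimal B f b \<longleftrightarrow> (\<exists>d. is_optimal S h (b, d))"
proof -
  show eq: "optimal_value B f = optimal_value S h"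
    unfolding optimal_value_def
  proof (rule antisym)
    show "Sup (f ` B) \<le> Sup (h ` S)"
      by (rule SUP_mono) (metis att order_refl)
    show "Sup (h ` S) \<le> Sup (f ` B)"
      by (rule SUP_mono) (metis le surj_pair)
  qed
  show "is_optimal B f b \<longleftrightarrow> (\<exists>d. is_optimal S h (b, d))"
  proof
    assume "is_optimal B f b"
    then show "\<exists>d. is_optimal S h (b, d)"
      using att[of b] by (auto simp: is_optimal_def eq)
  next
    assume "\<exists>d. is_optimal S h (b, d)"
    then obtain d where d: "is_optimal S h (b, d)" ..
    then have b: "b \<in> B" "h (b, d) \<le> f b"
      using le[of b d] by (simp_all add: is_optimal_def)
    \<comment> \<open>This closes the chain from the optimal value \<open>h (b, d)\<close> through
      \<open>f b\<close> back to the optimal value, forcing equality.\<close>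
    then have "f b \<le> optimal_value S h"
      unfolding eq[symmetric] by (simp add: optimal_value_def SUP_upper)
    with b d show "is_optimal B f b"
      by (auto simp: is_optimal_def eq)
  qed
qed

theorem mainTheorem3:
  fixes B :: "real set" and J :: "real \<Rightarrow> real \<Rightarrow> real"
    and m :: nat and x \<delta>lo \<delta>up :: "nat \<Rightarrow> real"
  assumes "convex B"
    and "continuous_on ({0..1} \<times> B) (\<lambda>(y, b). J y b)"
    and "\<And>y. y \<in> {0..1} \<Longrightarrow> concave_on B (\<lambda>b. J y b)"
    and "\<And>b. b \<in> B \<Longrightarrow> concave_on {0..1} (\<lambda>y. J y b)"
    and "x 0 = 0" and "x m = 1" and "\<And>i. i \<in> {1..m} \<Longrightarrow> x (i - 1) < x i"
    and "\<exists>F\<in>distributions. \<forall>i\<in>{1..m}.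
           \<delta>lo i < measure F (cell m x i) \<and> measure F (cell m x i) < \<delta>up i"
  shows "convex_maximization_problem (dual_feasible m x B J) (dual_objective m \<delta>lo \<delta>up) \<and>
    linear (dual_objective m \<delta>lo \<delta>up) \<and>
    optimal_value B (worst_case (ambiguity_set m x \<delta>lo \<delta>up) J)
      = optimal_value (dual_feasible m x B J) (\<lambda>p. ereal (dual_objective m \<delta>lo \<delta>up p)) \<and>
    (\<forall>b\<in>B. is_optimal B (worst_case (ambiguity_set m x \<delta>lo \<delta>up) J) b \<longleftrightarrow>
      (\<exists>\<mu>up \<mu>lo \<eta>. is_optimal (dual_feasible m x B J)
         (\<lambda>p. ereal (dual_objective m \<delta>lo \<delta>up p)) (b, \<mu>up, \<mu>lo, \<eta>)))"
proof -
  interpret partition m x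
    by standard (use assms in auto)
  have cont: "continuous_on {0..1} (\<lambda>y. J y b)" if "b \<in> B" for b
    using continuous_on_compose2[OF assms(2), of "{0..1}" "\<lambda>y. (y, b)"] that
    by (fastforce intro: continuous_on_Pair continuous_on_id continuous_on_const)
  have conv: "convex (dual_feasible m x B J)"
    using assms(1,3) x_in_unit by (intro convex_dual_feasible) auto
  \<comment> \<open>Strict bounds imply the weak ones, so the ambiguity set is nonempty.\<close>
  obtain F where F: "F \<in> ambiguity_set m x \<delta>lo \<delta>up"
    using assms(8) by (fastforce simp: ambiguity_set_def)
  let ?f = "worst_case (ambiguity_set m x \<delta>lo \<delta>up) J"
  let ?h = "\<lambda>p. ereal (dual_objective m \<delta>lo \<delta>up p)"
  \<comment> \<open>Weak duality bounds the objective for all multipliers; strong duality then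
    provides multipliers attaining the bound for each \<open>b\<close>.\<close>
  have le: "b \<in> B \<and> ?h (b, d) \<le> ?f b" if "(b, d) \<in> dual_feasible m x B J" for b d
  proof -
    have "b \<in> B"
      using that by (auto simp: dual_feasible_def)
    with that weak_duality[of J b] cont[of b] assms(4)[of b] show ?thesis
      by (cases d) auto
  qed
  have att: "\<exists>d. (b, d) \<in> dual_feasible m x B J \<and> ?h (b, d) = ?f b" if "b \<in> B" for b
    by (rule strong_duality[of J b B F, OF cont[OF that] assms(4)[OF that] that F]) auto
  note reformulation = optimal_value_projection[of "dual_feasible m x B J" B ?h ?f, OF le att]
  show ?thesis
    using conv linear_dual_objective concave_on_linear[OF conv linear_dual_objective] reformulation
    by (auto simp: convex_maximization_problem_def)
qed

end
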